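(* For almost every real number $\alpha>10$ (with respect to one-dimensional Lebesgue measure), the set $\mathrm{PS}(\alpha)$ contains at most finitely many arithmetic progressions of length $3$.
   Context: For real $\alpha>1$, $\mathrm{PS}(\alpha)=\{\lfloor n^\alpha\rfloor : n\in\mathbb{N}\}$, where $\mathbb{N}$ is the set of positive integers and $\lfloor x\rfloor$ is the integer part of $x$. An arithmetic progression of length $3$ in a set $S$ is a triple of distinct elements $x<y<z$ of $S$ with $x+z=2y$. *)

theory Defs
  imports "HOL-Analysis.Analysis"
begin

definition PS :: "real \<Rightarrow> int set" where
  "PS \<alpha> = {\<lfloor>real n powr \<alpha>\<rfloor> | n :: nat. n \<ge> 1}"

definition three_term_APs :: "int set \<Rightarrow> (int \<times> int \<times> int) set" where
  "three_term_APs S =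
     {(x, y, z). x \<in> S \<and> y \<in> S \<and> z \<in> S \<and> x < y \<and> y < z \<and> x + z = 2 * y}"

end

theory Submission
  imports Defs
begin

text \<open>
  A progression with indices \<open>l < m < n\<close> forces \<open>\<bar>X + 1 - 2 Y\<bar> \<le> \<eta>\<close>, where
  \<open>X = (l/n)\<^sup>\<alpha>\<close>, \<open>Y = (m/n)\<^sup>\<alpha>\<close> and \<open>\<eta> = 2 n\<^sup>-\<^sup>\<alpha>\<close>. Passing from \<open>\<alpha>\<close> to a larger exponent
  \<open>\<beta> = c \<alpha>\<close> applies \<open>t \<mapsto> t\<^sup>c\<close> to \<open>X\<close>, \<open>Y\<close>, \<open>1\<close>, and the strict convexity of this map destroys
  the approximate equality unless \<open>c - 1\<close> is of order \<open>\<eta> / (1 - X)\<^sup>2\<close>. Hence for \<open>\<alpha>\<close> in a unit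
  interval beyond 10, each triple \<open>(l, m, n)\<close> only admits exponents from an interval of length
  \<open>O(n\<^sup>-\<^sup>8)\<close>. As there are at most \<open>n\<^sup>2\<close> triples for each \<open>n\<close>, Borel--Cantelli applies.
\<close>

text \<open>Subtracting \<open>(c - 1) / 2 * t\<^sup>2\<close> from \<open>t powr c\<close> leaves a
  convex function on \<open>{0<..1}\<close>, because \<open>t powr (c - 2)\<close> is at least 1
  when \<open>c \<le> 2\<close>. Midpoint convexity between \<open>X\<close> and 1 then bounds the
  gap below by that of the quadratic.\<close>

lemma powr_second_difference_ge:
  fixes X c :: real
  assumes X: "0 < X" "X \<le> 1" and c: "1 \<le> c" "c \<le> 2"
  shows "(c - 1) * ((1 - X) / 2)\<^sup>2 \<le> X powr c + 1 - 2 * ((1 + X) / 2) powr c"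
proof -
  define g where "g t = t powr c - (c - 1) / 2 * t\<^sup>2" for t :: real
  have cvx: "convex_on {0<..1} g"
  proof (rule f''_ge0_imp_convex)
    show "convex {0<..1::real}" by simp
  next
    fix t :: real assume "t \<in> {0<..1}"
    hence t: "0 < t" "t \<le> 1" by auto
    show "DERIV g t :> c * t powr (c - 1) - (c - 1) * t"
      unfolding g_def using t by (auto intro!: derivative_eq_intros)
    show "DERIV (\<lambda>t. c * t powr (c - 1) - (c - 1) * t) t :>
            c * (c - 1) * t powr (c - 2) - (c - 1)"
      using t by (auto intro!: derivative_eq_intros)
    have "1 \<le> t powr (c - 2)"
      using t c powr_mono'[of "c - 2" 0 t] by simp
    hence "1 * 1 \<le> c * t powr (c - 2)"
      using c by (intro mult_mono) auto
    hence "(c - 1) * 1 \<le> (c - 1) * (c * t powr (c - 2))"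
      using c by (intro mult_left_mono) auto
    thus "0 \<le> c * (c - 1) * t powr (c - 2) - (c - 1)" by (simp add: mult_ac)
  qed
  have "g ((1 - 1/2) *\<^sub>R X + (1/2) *\<^sub>R 1) \<le> (1 - 1/2) * g X + (1/2) * g 1"
    using X by (intro convex_onD[OF cvx]) auto
  hence "2 * g ((1 + X) / 2) \<le> g X + g 1"
    by (simp add: field_simps)
  thus ?thesis unfolding g_def by (simp add: power2_eq_square field_simps)
qed

lemma powr_diff_le_unit_interval:
  fixes u v c :: real
  assumes "0 < u" "0 < v" "v \<le> 1" and c: "1 \<le> c"
  shows "v powr c - u powr c \<le> c * \<bar>v - u\<bar>"
proof (cases "u < v")
  case True
  have "\<exists>z. z > u \<and> z < v \<and> v powr c - u powr c = (v - u) * (c * z powr (c - 1))"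
    using assms True by (intro MVT2) (auto intro!: derivative_eq_intros)
  then obtain z where z: "u < z" "z < v" "v powr c - u powr c = (v - u) * (c * z powr (c - 1))"
    by blast
  have "z powr (c - 1) \<le> 1"
    using z assms by (intro powr_le1) auto
  hence "(v - u) * (c * z powr (c - 1)) \<le> (v - u) * (c * 1)"
    using True c by (intro mult_left_mono) auto
  thus ?thesis using z True by (simp add: mult_ac)
next
  case False
  hence "v powr c \<le> u powr c" using assms by (intro powr_mono2) auto
  moreover have "0 \<le> c * \<bar>v - u\<bar>" using c by simp
  ultimately show ?thesis by linarith
qed

lemma approximate_progression_exponents_close:
  fixes x y \<alpha> \<beta> \<eta> :: real
  assumes x: "0 < x" "x \<le> 1" and y: "0 < y" "y \<le> 1"
    and \<alpha>: "1 \<le> \<alpha>" "\<alpha> \<le> \<beta>" "\<beta> \<le> 2 * \<alpha>"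
    and near: "\<bar>x powr \<alpha> + 1 - 2 * y powr \<alpha>\<bar> \<le> \<eta>" "\<bar>x powr \<beta> + 1 - 2 * y powr \<beta>\<bar> \<le> \<eta>"
  shows "(\<beta> - \<alpha>) * (1 - x)\<^sup>2 \<le> 12 * \<alpha> * \<eta>"
proof -
  define c where "c = \<beta> / \<alpha>"
  have c: "1 \<le> c" "c \<le> 2" and c\<beta>: "\<beta> = \<alpha> * c" using \<alpha> by (auto simp: c_def field_simps)
  define X where "X = x powr \<alpha>"
  define Y where "Y = y powr \<alpha>"
  have X: "0 < X" "X \<le> x" using x \<alpha> powr_mono'[of 1 \<alpha> x] by (auto simp: X_def)
  have Y: "0 < Y" "Y \<le> 1" using y \<alpha> by (auto simp: Y_def intro: powr_le1)
  have pow: "x powr \<beta> = X powr c" "y powr \<beta> = Y powr c"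
    by (simp_all add: X_def Y_def c\<beta> powr_powr)
  define M where "M = (1 + X) / 2"
  have "(c - 1) * ((1 - X) / 2)\<^sup>2 \<le> X powr c + 1 - 2 * M powr c"
    unfolding M_def using X x c by (intro powr_second_difference_ge) auto
  moreover have "Y powr c - M powr c \<le> c * \<bar>Y - M\<bar>"
    using X Y c by (intro powr_diff_le_unit_interval) (auto simp: M_def)
  moreover have "c * \<bar>Y - M\<bar> \<le> 2 * (\<eta> / 2)"
    using c near(1) by (intro mult_mono) (auto simp: M_def X_def Y_def field_simps)
  moreover have "X powr c + 1 - 2 * Y powr c \<le> \<eta>"
    using near(2) by (simp add: pow)
  \<comment> \<open>Replacing \<open>M\<close> by \<open>Y\<close> costs at most 2 \<eta>, since
    \<open>Y\<close> is within \<eta>/2 of \<open>M\<close> and \<open>c \<le> 2\<close>; nearness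
    at \<beta> adds the third \<eta>.\<close>
  ultimately have "(c - 1) * ((1 - X) / 2)\<^sup>2 \<le> 3 * \<eta>" by linarith
  hence *: "(c - 1) * (1 - X)\<^sup>2 \<le> 12 * \<eta>" by (simp add: power_divide)
  \<comment> \<open>As \<open>X \<le> x\<close>, the gap can be stated through \<open>x\<close>,
    free of the exponent.\<close>
  have "(1 - x)\<^sup>2 \<le> (1 - X)\<^sup>2" using X x by (intro power_mono) auto
  hence "(\<beta> - \<alpha>) * (1 - x)\<^sup>2 \<le> (\<beta> - \<alpha>) * (1 - X)\<^sup>2" using \<alpha> by (intro mult_left_mono) auto
  also have "\<dots> = \<alpha> * ((c - 1) * (1 - X)\<^sup>2)" by (simp add: c\<beta> algebra_simps)
  also have "\<dots> \<le> \<alpha> * (12 * \<eta>)" using * \<alpha> by (intro mult_left_mono) auto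
  finally show ?thesis by (simp add: mult_ac)
qed

text \<open>Fixing the indices and collecting the exponents makes the exceptional set a countable
  union of pieces whose length can be estimated.\<close>

definition AP_exponents :: "nat \<Rightarrow> nat \<Rightarrow> nat \<Rightarrow> real set" where
  "AP_exponents l m n =
     {\<alpha>. \<lfloor>real l powr \<alpha>\<rfloor> + \<lfloor>real n powr \<alpha>\<rfloor> = 2 * \<lfloor>real m powr \<alpha>\<rfloor>}"

lemma AP_exponents_near:
  assumes \<alpha>: "\<alpha> \<in> AP_exponents l m n" "10 \<le> \<alpha>" and n: "1 \<le> n"
  shows "\<bar>(real l / real n) powr \<alpha> + 1 - 2 * (real m / real n) powr \<alpha>\<bar> \<le> 2 / real n ^ 10"
proof -
  have n0: "0 < real n" using n by simp
  \<comment> \<open>Three fractional parts with weights 1, 1, -2 combine to less than 2 in absolute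
    value.\<close>
  have "\<bar>real l powr \<alpha> + real n powr \<alpha> - 2 * real m powr \<alpha>\<bar> \<le> 2"
    using \<alpha>(1) unfolding AP_exponents_def by (simp, linarith)
  moreover have "(real l / real n) powr \<alpha> + 1 - 2 * (real m / real n) powr \<alpha> =
      (real l powr \<alpha> + real n powr \<alpha> - 2 * real m powr \<alpha>) / real n powr \<alpha>"
    using n0 by (simp add: powr_divide field_simps)
  ultimately have "\<bar>(real l / real n) powr \<alpha> + 1 - 2 * (real m / real n) powr \<alpha>\<bar>
      \<le> 2 / real n powr \<alpha>"
    using n0 by (simp add: divide_right_mono)
  also have "real n ^ 10 \<le> real n powr \<alpha>"
    using n0 n \<alpha>(2) powr_mono[of 10 \<alpha> "real n"] by (simp add: powr_numeral)
  hence "2 / real n powr \<alpha> \<le> 2 / real n ^ 10"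
    using n0 by (intro divide_left_mono) auto
  finally show ?thesis .
qed

lemma AP_exponents_close:
  assumes lmn: "1 \<le> l" "l < m" "m < n"
    and \<alpha>: "\<alpha> \<in> AP_exponents l m n" "10 \<le> \<alpha>"
    and \<beta>: "\<beta> \<in> AP_exponents l m n" "\<alpha> \<le> \<beta>" "\<beta> \<le> \<alpha> + 1"
  shows "\<beta> - \<alpha> \<le> 24 * \<alpha> / real n ^ 8"
proof -
  have n0: "0 < real n" using lmn by simp
  \<comment> \<open>The ratio condition \<open>\<beta> \<le> 2 * \<alpha>\<close> follows from
    \<open>\<beta> \<le> \<alpha> + 1\<close> and \<open>10 \<le> \<alpha>\<close>.\<close>
  have "(\<beta> - \<alpha>) * (1 - real l / real n)\<^sup>2 \<le> 12 * \<alpha> * (2 / real n ^ 10)"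
    using lmn \<alpha> \<beta> AP_exponents_near[of \<alpha> l m n] AP_exponents_near[of \<beta> l m n]
    by (intro approximate_progression_exponents_close[where y = "real m / real n"]) auto
  \<comment> \<open>Integrality of \<open>l < n\<close> gives a gap of at least
    \<open>1 / n\<close>; its square is what lowers the decay from \<open>n ^ 10\<close> to
    \<open>n ^ 8\<close>.\<close>
  moreover have "(1 / real n)\<^sup>2 \<le> (1 - real l / real n)\<^sup>2"
    using lmn by (intro power_mono) (auto simp: field_simps)
  hence "(\<beta> - \<alpha>) * (1 / real n)\<^sup>2 \<le> (\<beta> - \<alpha>) * (1 - real l / real n)\<^sup>2"
    using \<beta> by (intro mult_left_mono) auto
  ultimately have "(\<beta> - \<alpha>) * (1 / real n)\<^sup>2 \<le> 24 * \<alpha> / real n ^ 10" by simp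
  hence "(\<beta> - \<alpha>) * (1 / real n)\<^sup>2 * (real n)\<^sup>2 \<le> 24 * \<alpha> / real n ^ 10 * (real n)\<^sup>2"
    by (intro mult_right_mono) auto
  moreover have "24 * \<alpha> / real n ^ 10 * (real n)\<^sup>2 = 24 * \<alpha> / real n ^ 8"
    using n0 by (simp add: field_simps flip: power_add)
  ultimately show ?thesis using n0 by (simp add: power_divide)
qed

text \<open>Any member of the set in the unit interval serves as centre, since all the others are
  close to it; for an empty intersection every centre works.\<close>

lemma AP_exponents_subset_cball:
  assumes lmn: "1 \<le> l" "l < m" "m < n" and a: "10 \<le> a"
  shows "\<exists>c. AP_exponents l m n \<inter> {a..a + 1} \<subseteq> cball c (24 * (a + 1) / real n ^ 8)"
proof (cases "AP_exponents l m n \<inter> {a..a + 1} = {}")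
  case False
  then obtain c where c: "c \<in> AP_exponents l m n" "c \<in> {a..a + 1}" by blast
  have "\<beta> \<in> cball c (24 * (a + 1) / real n ^ 8)"
    if \<beta>: "\<beta> \<in> AP_exponents l m n" "\<beta> \<in> {a..a + 1}" for \<beta>
  proof -
    have "\<bar>\<beta> - c\<bar> \<le> 24 * min \<beta> c / real n ^ 8"
    proof (cases "\<beta> \<le> c")
      case True
      thus ?thesis using AP_exponents_close[OF lmn \<beta>(1) _ c(1)] \<beta> c a by simp
    next
      case False
      thus ?thesis using AP_exponents_close[OF lmn c(1) _ \<beta>(1)] \<beta> c a by simp
    qed
    also have "\<dots> \<le> 24 * (a + 1) / real n ^ 8"
      using \<beta> c by (intro divide_right_mono) auto
    finally show ?thesis by (simp add: dist_real_def abs_minus_commute)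
  qed
  thus ?thesis by blast
qed simp

lemma AE_eventually_no_AP_exponents:
  fixes a :: real
  assumes a: "10 \<le> a"
  shows "AE \<alpha> in lebesgue. \<alpha> \<in> {a..a + 1} \<longrightarrow>
    (\<forall>\<^sub>F n in sequentially. \<forall>l m. 1 \<le> l \<longrightarrow> l < m \<longrightarrow> m < n \<longrightarrow> \<alpha> \<notin> AP_exponents l m n)"
proof -
  define D where "D n = 24 * (a + 1) / real n ^ 8" for n
  have D0: "0 \<le> D n" for n using a by (simp add: D_def)
  obtain c where c: "AP_exponents l m n \<inter> {a..a + 1} \<subseteq> cball (c l m n) (D n)"
    if "1 \<le> l" "l < m" "m < n" for l m n
    unfolding D_def using AP_exponents_subset_cball[OF _ _ _ a] by metis
  \<comment> \<open>Balls stand in for the exponent sets so that measurability is immediate. Pairs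
    violating \<open>1 \<le> l < m < n\<close> get an arbitrary centre, which still contributes only
    a ball of radius \<open>D n\<close>.\<close>
  define A where "A n = (\<Union>(l, m)\<in>{..<n} \<times> {..<n}. cball (c l m n) (D n))" for n
  have meas: "A n \<in> lmeasurable" for n
    unfolding A_def by (intro fmeasurable.finite_UN) (auto split: prod.split)
  have bound: "measure lebesgue (A n) \<le> 48 * (a + 1) * (1 / real n ^ 6)" for n
  proof -
    have "measure lebesgue (A n) \<le>
        (\<Sum>p\<in>{..<n} \<times> {..<n}. measure lebesgue (case p of (l, m) \<Rightarrow> cball (c l m n) (D n)))"
      unfolding A_def by (intro measure_UNION_le) (auto split: prod.split)
    also have "\<dots> = (\<Sum>p\<in>{..<n} \<times> {..<n}. 2 * D n)"
      using D0[of n] by (intro sum.cong) (auto simp: cball_eq_atLeastAtMost)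
    also have "\<dots> = real n ^ 2 * (2 * D n)" by (simp add: power2_eq_square)
    also have "\<dots> = 48 * (a + 1) * (real n ^ 2 / real n ^ 8)" by (simp add: D_def)
    also have "real n ^ 2 / real n ^ 8 = 1 / real n ^ 6"
      \<comment> \<open>At \<open>n = 0\<close> both quotients are 0 by the convention for division
        by zero.\<close>
      by (cases "n = 0") (simp_all add: divide_eq_eq eq_divide_eq flip: power_add)
    finally show ?thesis .
  qed
  have summ: "summable (\<lambda>n. measure lebesgue (A n))"
  proof (rule summable_comparison_test')
    show "summable (\<lambda>n. 48 * (a + 1) * (1 / real n ^ 6))"
      using inverse_power_summable[of 6, where ?'a = real]
      by (intro summable_mult) (simp add: inverse_eq_divide)
    show "norm (measure lebesgue (A n)) \<le> 48 * (a + 1) * (1 / real n ^ 6)" for n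
      using bound[of n] by simp
  qed
  have "AE \<alpha> in lebesgue. \<forall>\<^sub>F n in sequentially. \<alpha> \<in> space lebesgue - A n"
    using meas summ by (intro borel_cantelli_AE1) (simp_all add: fmeasurable_def del: emeasure_completion)
  thus ?thesis
  proof eventually_elim
    case (elim \<alpha>)
    show ?case
    proof
      assume "\<alpha> \<in> {a..a + 1}"
      with c show "\<forall>\<^sub>F n in sequentially.
          \<forall>l m. 1 \<le> l \<longrightarrow> l < m \<longrightarrow> m < n \<longrightarrow> \<alpha> \<notin> AP_exponents l m n"
        by (intro eventually_mono[OF elim]) (fastforce simp: A_def)
    qed
  qed
qed

text \<open>By monotonicity of \<open>p\<close>, increasing terms have increasing indices, so
  bounding the largest index confines all three terms to a finite image.\<close>

lemma finite_three_term_APs_PS: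
  assumes \<alpha>: "0 \<le> \<alpha>"
    and ev: "\<forall>\<^sub>F n in sequentially.
      \<forall>l m. 1 \<le> l \<longrightarrow> l < m \<longrightarrow> m < n \<longrightarrow> \<alpha> \<notin> AP_exponents l m n"
  shows "finite (three_term_APs (PS \<alpha>))"
proof -
  define p where "p k = \<lfloor>real k powr \<alpha>\<rfloor>" for k
  have p_mono: "p k \<le> p k'" if "k \<le> k'" for k k'
    unfolding p_def using that \<alpha> by (intro floor_mono powr_mono2) auto
  hence p_less: "k < k'" if "p k < p k'" for k k'
    using that by (meson not_less)
  obtain N where N: "\<alpha> \<notin> AP_exponents l m n"
    if "N \<le> n" "1 \<le> l" "l < m" "m < n" for l m n
    using ev unfolding eventually_sequentially by blast
  have "three_term_APs (PS \<alpha>) \<subseteq> p ` {..<N} \<times> p ` {..<N} \<times> p ` {..<N}"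
  proof safe
    fix x y z assume "(x, y, z) \<in> three_term_APs (PS \<alpha>)"
    then obtain l m n where lmn: "1 \<le> l" "x = p l" "y = p m" "z = p n"
      and AP: "p l < p m" "p m < p n" "p l + p n = 2 * p m"
      unfolding three_term_APs_def PS_def p_def by auto
    have "l < m" "m < n" using AP p_less by blast+
    moreover have "\<alpha> \<in> AP_exponents l m n"
      using AP by (simp add: AP_exponents_def p_def)
    ultimately have "n < N" using N lmn(1) by (meson not_less)
    thus "x \<in> p ` {..<N}" "y \<in> p ` {..<N}" "z \<in> p ` {..<N}"
      using \<open>l < m\<close> \<open>m < n\<close> lmn by auto
  qed
  thus ?thesis by (rule finite_subset) simp
qed

theorem theorem1p3:
  shows "AE \<alpha> in lebesgue. \<alpha> > (10 :: real) \<longrightarrow> finite (three_term_APs (PS \<alpha>))"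
proof -
  \<comment> \<open>The measure bound depends on the left endpoint \<open>a\<close>, so the
    half-line is covered by countably many unit intervals and the null sets are united.\<close>
  have "AE \<alpha> in lebesgue. \<forall>k::nat. \<alpha> \<in> {10 + real k..10 + real k + 1} \<longrightarrow>
      (\<forall>\<^sub>F n in sequentially. \<forall>l m. 1 \<le> l \<longrightarrow> l < m \<longrightarrow> m < n \<longrightarrow> \<alpha> \<notin> AP_exponents l m n)"
    unfolding AE_all_countable by (intro allI AE_eventually_no_AP_exponents) simp
  thus ?thesis
  proof eventually_elim
    case (elim \<alpha>)
    show ?case
    proof
      assume "10 < \<alpha>"
      define k where "k = nat \<lfloor>\<alpha> - 10\<rfloor>"
      have "\<alpha> \<in> {10 + real k..10 + real k + 1}"
        using \<open>10 < \<alpha>\<close> unfolding k_def atLeastAtMost_iff by linarith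
      with elim show "finite (three_term_APs (PS \<alpha>))"
        using \<open>10 < \<alpha>\<close> by (intro finite_three_term_APs_PS) auto
    qed
  qed
qed

end
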